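(* Let $\underline{B}=(B,\leq,0,1,+,C)$ be a distributive contact join-semilattice. Then there is a compact, semiregular, $T_0$ topological space $X$ and an isomorphic embedding $h$ of $\underline{B}$ into the structure $(RC(X),\subseteq,\emptyset,X,\cup,C_X)$, where $RC(X)$ is the set of regular closed subsets of $X$ and $a\,C_X\,b$ iff $a\cap b\neq\emptyset$.
   Context: A subset of a topological space is regular closed if it equals the closure of its interior. A distributive contact join-semilattice (DCJS) is a structure $(B,\leq,0,1,+,C)$ with $B$ a set, $0,1\in B$, $+$ a binary operation, and $\leq$, $C$ binary relations on $B$, satisfying for all elements: (1) $x\leq x$; (2) $x\leq y\wedge y\leq x\rightarrow x=y$; (3) $x\leq y\wedge y\leq z\rightarrow x\leq z$; (4) $x+y=y+x$; (5) $x\leq x+y$; (6) $x\leq z\wedge y\leq z\rightarrow x+y\leq z$; (7) $0\leq x$; (8) $x\leq 1$; (9) $xCy\rightarrow x\neq 0$; (10) $xCy\rightarrow yCx$; (11) $xC(y+z)\rightarrow xCy$ or $xCz$; (12) $xCy\wedge y\leq y'\rightarrow xCy'$; (13) $x\neq 0\rightarrow xCx$; (ad) if $x\leq a+b$ then there exist $a'\leq a$, $b'\leq b$ with $x=a'+b'$. An isomorphic embedding of $(B,\leq,0,1,+,C)$ into $(B',\leq',0',1',+',C')$ is an injective map $h$ with $h(0)=0'$, $h(1)=1'$, $h(a+b)=h(a)+'h(b)$, $a\leq b\iff h(a)\leq' h(b)$, and $aCb\iff h(a)C'h(b)$. *)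

theory Defs
  imports "HOL-Analysis.Analysis"
begin

record 'a contact_structure =
  univ :: "'a set"
  leq :: "'a \<Rightarrow> 'a \<Rightarrow> bool"  (infix "\<preceq>\<index>" 50)
  bottom :: 'a  ("\<zero>\<index>")
  top_elem :: 'a  ("\<one>\<index>")
  plus_op :: "'a \<Rightarrow> 'a \<Rightarrow> 'a"  (infixl "\<oplus>\<index>" 65)
  contact :: "'a \<Rightarrow> 'a \<Rightarrow> bool"  (infix "\<bowtie>\<index>" 50)

text \<open>No nondegeneracy axiom is imposed: the one-element structure, in which
  bottom and top coincide, is a model.\<close>

locale dcjs =
  fixes B :: "'a contact_structure" (structure)
  assumes zero_closed: "\<zero> \<in> univ B"
    and one_closed: "\<one> \<in> univ B"
    and plus_closed: "\<lbrakk>x \<in> univ B; y \<in> univ B\<rbrakk> \<Longrightarrow> x \<oplus> y \<in> univ B"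
    and le_refl: "x \<in> univ B \<Longrightarrow> x \<preceq> x"
    and le_antisym: "\<lbrakk>x \<in> univ B; y \<in> univ B; x \<preceq> y; y \<preceq> x\<rbrakk> \<Longrightarrow> x = y"
    and le_trans: "\<lbrakk>x \<in> univ B; y \<in> univ B; z \<in> univ B; x \<preceq> y; y \<preceq> z\<rbrakk> \<Longrightarrow> x \<preceq> z"
    and plus_commute: "\<lbrakk>x \<in> univ B; y \<in> univ B\<rbrakk> \<Longrightarrow> x \<oplus> y = y \<oplus> x"
    and le_plus: "\<lbrakk>x \<in> univ B; y \<in> univ B\<rbrakk> \<Longrightarrow> x \<preceq> x \<oplus> y"
    and plus_least: "\<lbrakk>x \<in> univ B; y \<in> univ B; z \<in> univ B; x \<preceq> z; y \<preceq> z\<rbrakk> \<Longrightarrow> x \<oplus> y \<preceq> z"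
    and zero_le: "x \<in> univ B \<Longrightarrow> \<zero> \<preceq> x"
    and le_one: "x \<in> univ B \<Longrightarrow> x \<preceq> \<one>"
    and contact_nonzero: "\<lbrakk>x \<in> univ B; y \<in> univ B; x \<bowtie> y\<rbrakk> \<Longrightarrow> x \<noteq> \<zero>"
    and contact_sym: "\<lbrakk>x \<in> univ B; y \<in> univ B; x \<bowtie> y\<rbrakk> \<Longrightarrow> y \<bowtie> x"
    and contact_plus:
      "\<lbrakk>x \<in> univ B; y \<in> univ B; z \<in> univ B; x \<bowtie> (y \<oplus> z)\<rbrakk> \<Longrightarrow> x \<bowtie> y \<or> x \<bowtie> z"
    and contact_mono:
      "\<lbrakk>x \<in> univ B; y \<in> univ B; y' \<in> univ B; x \<bowtie> y; y \<preceq> y'\<rbrakk> \<Longrightarrow> x \<bowtie> y'"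
    and contact_refl: "\<lbrakk>x \<in> univ B; x \<noteq> \<zero>\<rbrakk> \<Longrightarrow> x \<bowtie> x"
    and distrib:
      "\<lbrakk>x \<in> univ B; a \<in> univ B; b \<in> univ B; x \<preceq> a \<oplus> b\<rbrakk>
        \<Longrightarrow> \<exists>a'\<in>univ B. \<exists>b'\<in>univ B. a' \<preceq> a \<and> b' \<preceq> b \<and> x = a' \<oplus> b'"

definition isomorphic_embedding ::
    "('a \<Rightarrow> 'b) \<Rightarrow> 'a contact_structure \<Rightarrow> 'b contact_structure \<Rightarrow> bool" where
  "isomorphic_embedding h B B' \<longleftrightarrow>
     h ` univ B \<subseteq> univ B' \<and> inj_on h (univ B) \<and>
     h \<zero>\<^bsub>B\<^esub> = \<zero>\<^bsub>B'\<^esub> \<and> h \<one>\<^bsub>B\<^esub> = \<one>\<^bsub>B'\<^esub> \<and>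
     (\<forall>a\<in>univ B. \<forall>b\<in>univ B. h (a \<oplus>\<^bsub>B\<^esub> b) = h a \<oplus>\<^bsub>B'\<^esub> h b) \<and>
     (\<forall>a\<in>univ B. \<forall>b\<in>univ B. a \<preceq>\<^bsub>B\<^esub> b \<longleftrightarrow> h a \<preceq>\<^bsub>B'\<^esub> h b) \<and>
     (\<forall>a\<in>univ B. \<forall>b\<in>univ B. a \<bowtie>\<^bsub>B\<^esub> b \<longleftrightarrow> h a \<bowtie>\<^bsub>B'\<^esub> h b)"

definition regular_closed_sets :: "'b topology \<Rightarrow> 'b set set" where
  "regular_closed_sets X = {a. a \<subseteq> topspace X \<and> a = X closure_of (X interior_of a)}"

text \<open>Semiregular means that the regular closed sets form a base for the closed sets
  (no separation axiom is included). The intersection with the whole space only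
  matters for the empty family.\<close>

definition semiregular_space :: "'b topology \<Rightarrow> bool" where
  "semiregular_space X \<longleftrightarrow>
     (\<forall>F. closedin X F \<longrightarrow> (\<exists>\<A>\<subseteq>regular_closed_sets X. F = topspace X \<inter> \<Inter>\<A>))"

definition RC_structure :: "'b topology \<Rightarrow> 'b set contact_structure" where
  "RC_structure X =
     \<lparr>univ = regular_closed_sets X, leq = (\<subseteq>), bottom = {}, top_elem = topspace X,
      plus_op = (\<union>), contact = (\<lambda>a b. a \<inter> b \<noteq> {})\<rparr>"

end

theory Submission
  imports Defs
begin

text \<open>The idea: let \<open>S\<close> be the set of prime filters of the semilattice, where filters are
  down-directed, and relate two prime filters when all their elements are pairwise in contact.
  Distributivity makes the complement of a maximal ideal avoiding a given element down-directed,
  so the map sending an element to the set of prime filters containing it embeds the semilattice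
  into \<open>Pow S\<close>, a Boolean algebra with contact. The points of the space are the clans of
  \<open>Pow S\<close>; complementation in \<open>Pow S\<close> is what makes the basic closed sets regular. The
  clans form a closed subset of the Cantor cube \<open>2 ^ Pow S\<close>, whose topology is finer, hence
  compactness.\<close>

section \<open>The clan space of a reflexive symmetric relation\<close>

text \<open>Grills on \<open>S\<close> whose members are pairwise in contact, two sets being in
  contact when some of their points are related by \<open>R\<close>. The equivalence for unions
  packs upward closure (take \<open>A \<subseteq> D\<close>) together with primeness. Each clause
  concerns finitely many sets at a time, which makes the clans closed in the Cantor cube.\<close>

definition clans :: "'s set \<Rightarrow> ('s \<Rightarrow> 's \<Rightarrow> bool) \<Rightarrow> 's set set set" where
  "clans S R = {\<Gamma>. \<Gamma> \<subseteq> Pow S \<and> S \<in> \<Gamma> \<and> {} \<notin> \<Gamma> \<and>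
     (\<forall>A D. A \<subseteq> S \<longrightarrow> D \<subseteq> S \<longrightarrow> (A \<union> D \<in> \<Gamma> \<longleftrightarrow> A \<in> \<Gamma> \<or> D \<in> \<Gamma>)) \<and>
     (\<forall>A D. A \<in> \<Gamma> \<longrightarrow> D \<in> \<Gamma> \<longrightarrow> (\<exists>u\<in>A. \<exists>v\<in>D. R u v))}"

definition clan_set :: "'s set \<Rightarrow> ('s \<Rightarrow> 's \<Rightarrow> bool) \<Rightarrow> 's set \<Rightarrow> 's set set set" where
  "clan_set S R A = {\<Gamma> \<in> clans S R. A \<in> \<Gamma>}"

text \<open>Complements of clan sets are the basic open sets. Only non-membership
  \<open>A \<notin> \<Gamma>\<close> is an open condition; making membership open as well would give
  the subspace topology of the Cantor cube.\<close>

definition clan_space :: "'s set \<Rightarrow> ('s \<Rightarrow> 's \<Rightarrow> bool) \<Rightarrow> 's set set topology" where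
  "clan_space S R = topology (\<lambda>U. U \<subseteq> clans S R \<and>
     (\<forall>\<Gamma>\<in>U. \<exists>A\<subseteq>S. A \<notin> \<Gamma> \<and> clans S R - clan_set S R A \<subseteq> U))"

lemma clan_set_subset: "clan_set S R A \<subseteq> clans S R"
  by (auto simp: clan_set_def)

lemma clan_set_empty: "clan_set S R {} = {}"
  by (auto simp: clan_set_def clans_def)

lemma clan_set_full: "clan_set S R S = clans S R"
  by (auto simp: clan_set_def clans_def)

lemma clan_set_Un:
  "A \<subseteq> S \<Longrightarrow> D \<subseteq> S \<Longrightarrow> clan_set S R (A \<union> D) = clan_set S R A \<union> clan_set S R D"
  by (auto simp: clan_set_def clans_def)

lemma openin_clan_space:
  "openin (clan_space S R) U \<longleftrightarrow> U \<subseteq> clans S R \<and>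
     (\<forall>\<Gamma>\<in>U. \<exists>A\<subseteq>S. A \<notin> \<Gamma> \<and> clans S R - clan_set S R A \<subseteq> U)"
proof -
  have "istopology (\<lambda>U. U \<subseteq> clans S R \<and>
     (\<forall>\<Gamma>\<in>U. \<exists>A\<subseteq>S. A \<notin> \<Gamma> \<and> clans S R - clan_set S R A \<subseteq> U))" (is "istopology ?P")
    unfolding istopology_def
  proof (intro conjI allI impI)
    fix U V assume U: "?P U" and V: "?P V"
    show "U \<inter> V \<subseteq> clans S R" using U by auto
    show "\<forall>\<Gamma>\<in>U \<inter> V. \<exists>A\<subseteq>S. A \<notin> \<Gamma> \<and> clans S R - clan_set S R A \<subseteq> U \<inter> V"
    proof
      fix \<Gamma> assume \<Gamma>: "\<Gamma> \<in> U \<inter> V"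
      then obtain A D where A: "A \<subseteq> S" "A \<notin> \<Gamma>" "clans S R - clan_set S R A \<subseteq> U"
        and D: "D \<subseteq> S" "D \<notin> \<Gamma>" "clans S R - clan_set S R D \<subseteq> V"
        using U V by (meson IntD1 IntD2)
      have "\<Gamma> \<in> clans S R" using \<Gamma> U by auto
      \<comment> \<open>By primeness, the basic neighbourhood given by \<open>A \<union> D\<close>
        still contains \<Gamma>, and it is the intersection of the two given ones.\<close>
      then have "A \<union> D \<notin> \<Gamma>" using A(1,2) D(1,2) by (simp add: clans_def)
      moreover have "clans S R - clan_set S R (A \<union> D) \<subseteq> U \<inter> V"
        using A D clan_set_Un by blast
      ultimately show "\<exists>A\<subseteq>S. A \<notin> \<Gamma> \<and> clans S R - clan_set S R A \<subseteq> U \<inter> V"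
        using A(1) D(1) by (meson Un_least)
    qed
  next
    fix \<K> assume "\<forall>K\<in>\<K>. ?P K"
    then show "\<Union>\<K> \<subseteq> clans S R"
      and "\<forall>\<Gamma>\<in>\<Union>\<K>. \<exists>A\<subseteq>S. A \<notin> \<Gamma> \<and> clans S R - clan_set S R A \<subseteq> \<Union>\<K>"
      by (blast, meson Union_iff Union_upper subset_trans)
  qed
  then show ?thesis by (simp add: clan_space_def)
qed

lemma openin_compl_clan_set:
  "A \<subseteq> S \<Longrightarrow> openin (clan_space S R) (clans S R - clan_set S R A)"
  by (auto simp: openin_clan_space clan_set_def)

lemma topspace_clan_space [simp]: "topspace (clan_space S R) = clans S R"
proof
  show "topspace (clan_space S R) \<subseteq> clans S R"
    using openin_clan_space openin_topspace by blast
  show "clans S R \<subseteq> topspace (clan_space S R)"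
    using openin_compl_clan_set[of "{}" S R] openin_subset by (fastforce simp: clan_set_empty)
qed

lemma closedin_clan_set: "A \<subseteq> S \<Longrightarrow> closedin (clan_space S R) (clan_set S R A)"
  by (simp add: closedin_def clan_set_subset openin_compl_clan_set)

text \<open>A clan outside \<open>F\<close> has a basic neighbourhood missing \<open>F\<close>; the
  complement of that neighbourhood is a clan set that includes \<open>F\<close> and omits the
  clan.\<close>

lemma closedin_clan_space_Inter:
  assumes "closedin (clan_space S R) F"
  shows "F = clans S R \<inter> \<Inter>(clan_set S R ` {A. A \<subseteq> S \<and> F \<subseteq> clan_set S R A})"
proof
  show "F \<subseteq> clans S R \<inter> \<Inter>(clan_set S R ` {A. A \<subseteq> S \<and> F \<subseteq> clan_set S R A})"
    using closedin_subset[OF assms] by auto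
  show "clans S R \<inter> \<Inter>(clan_set S R ` {A. A \<subseteq> S \<and> F \<subseteq> clan_set S R A}) \<subseteq> F"
  proof (rule ccontr)
    assume "\<not> ?thesis"
    then obtain \<Gamma> where \<Gamma>: "\<Gamma> \<in> clans S R" "\<Gamma> \<notin> F"
      "\<And>A. A \<subseteq> S \<Longrightarrow> F \<subseteq> clan_set S R A \<Longrightarrow> \<Gamma> \<in> clan_set S R A" by auto
    have "openin (clan_space S R) (clans S R - F)" using assms by (simp add: closedin_def)
    then obtain A where "A \<subseteq> S" "A \<notin> \<Gamma>" "clans S R - clan_set S R A \<subseteq> clans S R - F"
      using \<Gamma>(1,2) unfolding openin_clan_space by (meson DiffI)
    moreover have "F \<subseteq> clans S R" using closedin_subset[OF assms] by simp
    ultimately have "\<Gamma> \<in> clan_set S R A" using \<Gamma>(3) by blast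
    with \<open>A \<notin> \<Gamma>\<close> show False by (simp add: clan_set_def)
  qed
qed

text \<open>Distinct clans differ on some \<open>A \<subseteq> S\<close>, and then the complement of
  \<open>clan_set S R A\<close> contains exactly one of them.\<close>

lemma t0_clan_space: "t0_space (clan_space S R)"
  unfolding t0_space_def
proof (intro ballI impI)
  fix \<Gamma> \<Delta> assume "\<Gamma> \<in> topspace (clan_space S R)" "\<Delta> \<in> topspace (clan_space S R)" "\<Gamma> \<noteq> \<Delta>"
  then have \<Gamma>: "\<Gamma> \<in> clans S R" and \<Delta>: "\<Delta> \<in> clans S R" by auto
  then have "\<Gamma> \<subseteq> Pow S" "\<Delta> \<subseteq> Pow S" by (simp_all add: clans_def)
  then obtain A where "A \<subseteq> S" "A \<in> \<Gamma> \<longleftrightarrow> A \<notin> \<Delta>" using \<open>\<Gamma> \<noteq> \<Delta>\<close> by blast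
  then show "\<exists>U. openin (clan_space S R) U \<and> (\<Gamma> \<notin> U) = (\<Delta> \<in> U)"
    using \<Gamma> \<Delta> openin_compl_clan_set[of A S R]
    by (intro exI[of _ "clans S R - clan_set S R A"]) (auto simp: clan_set_def)
qed

section \<open>Compactness\<close>

text \<open>Clans are identified with their characteristic functions. By Tychonoff the cube
  \<open>P\<close> is compact, the clans form a closed subset \<open>K\<close>, and
  \<open>Collect\<close> maps \<open>K\<close> continuously onto the clan space.\<close>

lemma compact_clan_space: "compact_space (clan_space S R)"
proof -
  define P :: "('a set \<Rightarrow> bool) topology" where
    "P = product_topology (\<lambda>_. discrete_topology UNIV) UNIV"
  have top: "topspace P = UNIV" by (simp add: P_def)
  have comp: "compact_space P"
    by (simp add: P_def compact_space_product_topology compact_space_discrete_topology)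
  have coord: "openin P {g. g A = b}" for A b
    using openin_continuous_map_preimage[of P "discrete_topology UNIV" "\<lambda>g. g A" "{b}"]
      continuous_map_product_projection[of A UNIV "\<lambda>_. discrete_topology UNIV"]
    by (simp add: P_def top[unfolded P_def])
  have cyl: "openin P {g. \<forall>A\<in>\<F>. g A = f A}" if "finite \<F>" for \<F> and f :: "'a set \<Rightarrow> bool"
    using that
  proof induction
    case empty then show ?case using openin_topspace[of P] by (simp add: top)
  next
    case (insert A \<F>)
    have "{g. \<forall>D\<in>insert A \<F>. g D = f D} = {g. g A = f A} \<inter> {g. \<forall>A\<in>\<F>. g A = f A}" by auto
    then show ?case using coord insert.IH by auto
  qed
  define K where "K = {f. Collect f \<in> clans S R}"
  have "openin P (UNIV - K)"
    unfolding openin_subopen[of P "UNIV - K"]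
  proof
    fix f assume "f \<in> UNIV - K"
    then have f: "Collect f \<notin> clans S R" by (simp add: K_def)
    \<comment> \<open>A failure to be a clan is already visible on one pair \<open>A\<close>,
      \<open>D\<close>, so it depends on only five coordinates of \<open>f\<close>. Every
      \<open>g\<close> that agrees with \<open>f\<close> there fails in the same way.\<close>
    have "\<exists>A D. \<not> ((f A \<longrightarrow> A \<subseteq> S) \<and> f S \<and> \<not> f {} \<and>
        (A \<subseteq> S \<longrightarrow> D \<subseteq> S \<longrightarrow> (f (A \<union> D) \<longleftrightarrow> f A \<or> f D)) \<and>
        (f A \<longrightarrow> f D \<longrightarrow> (\<exists>u\<in>A. \<exists>v\<in>D. R u v)))"
    proof (rule ccontr)
      assume "\<not> ?thesis"
      then have "Collect f \<in> clans S R" unfolding clans_def mem_Collect_eq by blast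
      with f show False by contradiction
    qed
    then obtain A D where AD: "\<not> ((f A \<longrightarrow> A \<subseteq> S) \<and> f S \<and> \<not> f {} \<and>
        (A \<subseteq> S \<longrightarrow> D \<subseteq> S \<longrightarrow> (f (A \<union> D) \<longleftrightarrow> f A \<or> f D)) \<and>
        (f A \<longrightarrow> f D \<longrightarrow> (\<exists>u\<in>A. \<exists>v\<in>D. R u v)))" by blast
    let ?W = "{g. \<forall>E\<in>{S, {}, A, D, A \<union> D}. g E = f E}"
    have "g \<notin> K" if "g \<in> ?W" for g
    proof
      assume "g \<in> K"
      then have "(g A \<longrightarrow> A \<subseteq> S) \<and> g S \<and> \<not> g {} \<and>
        (A \<subseteq> S \<longrightarrow> D \<subseteq> S \<longrightarrow> (g (A \<union> D) \<longleftrightarrow> g A \<or> g D)) \<and>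
        (g A \<longrightarrow> g D \<longrightarrow> (\<exists>u\<in>A. \<exists>v\<in>D. R u v))"
        unfolding K_def clans_def mem_Collect_eq by blast
      moreover have "g S = f S" "g {} = f {}" "g A = f A" "g D = f D" "g (A \<union> D) = f (A \<union> D)"
        using that by auto
      ultimately show False using AD by simp
    qed
    then have "?W \<subseteq> UNIV - K" by blast
    then show "\<exists>T. openin P T \<and> f \<in> T \<and> T \<subseteq> UNIV - K"
      using cyl[of "{S, {}, A, D, A \<union> D}" f] by (intro exI[of _ ?W]) auto
  qed
  then have "closedin P K" by (simp add: closedin_def top)
  then have "compact_space (subtopology P K)"
    using comp closedin_compact_space compact_space_subtopology by blast
  moreover have "continuous_map (subtopology P K) (clan_space S R) Collect"
    unfolding continuous_map_def
  proof (intro conjI allI impI)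
    show "Collect \<in> topspace (subtopology P K) \<rightarrow> topspace (clan_space S R)"
      by (auto simp: K_def)
    fix U assume U: "openin (clan_space S R) U"
    show "openin (subtopology P K) {f \<in> topspace (subtopology P K). Collect f \<in> U}"
      unfolding openin_subopen[of _ "{f \<in> topspace (subtopology P K). Collect f \<in> U}"]
    proof
      fix f assume "f \<in> {f \<in> topspace (subtopology P K). Collect f \<in> U}"
      then have f: "f \<in> K" "Collect f \<in> U" by (auto simp: top)
      then obtain A where A: "\<not> f A" "clans S R - clan_set S R A \<subseteq> U"
        using U unfolding openin_clan_space by (metis mem_Collect_eq)
      \<comment> \<open>The preimage of a basic open set is cut out of \<open>K\<close> by the
        single coordinate condition that \<open>g A\<close> is false.\<close>
      have "openin (subtopology P K) ({g. g A = False} \<inter> K)"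
        using coord by (auto simp: openin_subtopology)
      moreover have "{g. g A = False} \<inter> K \<subseteq> {f \<in> topspace (subtopology P K). Collect f \<in> U}"
        using A(2) by (auto simp: K_def top clan_set_def)
      ultimately show "\<exists>T. openin (subtopology P K) T \<and> f \<in> T \<and>
          T \<subseteq> {f \<in> topspace (subtopology P K). Collect f \<in> U}"
        using f A(1) by (intro exI[of _ "{g. g A = False} \<inter> K"]) simp
    qed
  qed
  moreover have "Collect ` topspace (subtopology P K) = topspace (clan_space S R)"
  proof
    show "topspace (clan_space S R) \<subseteq> Collect ` topspace (subtopology P K)"
    proof
      fix \<Gamma> assume "\<Gamma> \<in> topspace (clan_space S R)"
      then have "(\<lambda>A. A \<in> \<Gamma>) \<in> topspace (subtopology P K)" by (simp add: K_def top)
      moreover have "\<Gamma> = Collect (\<lambda>A. A \<in> \<Gamma>)" by simp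
      ultimately show "\<Gamma> \<in> Collect ` topspace (subtopology P K)" by blast
    qed
  qed (auto simp: K_def)
  ultimately show ?thesis
    using image_compactin[of "subtopology P K" "topspace (subtopology P K)" "clan_space S R" Collect]
    by (simp add: compact_space_def)
qed

section \<open>Regular closed sets for a reflexive and symmetric relation\<close>

context
  fixes S :: "'s set" and R :: "'s \<Rightarrow> 's \<Rightarrow> bool"
  assumes refl: "u \<in> S \<Longrightarrow> R u u"
    and sym: "u \<in> S \<Longrightarrow> v \<in> S \<Longrightarrow> R u v \<Longrightarrow> R v u"
begin

text \<open>This is the union of the principal ultrafilters at \<open>u\<close> and
  \<open>v\<close>. Members sharing one of the two points touch by reflexivity, the others by
  \<open>R u v\<close> or its converse. These clans supply all the points needed to separate sets
  and to witness contact.\<close>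

lemma pair_clan:
  assumes "u \<in> S" "v \<in> S" "R u v"
  shows "{A. A \<subseteq> S \<and> (u \<in> A \<or> v \<in> A)} \<in> clans S R"
proof -
  have "\<exists>x\<in>A. \<exists>y\<in>D. R x y" if "u \<in> A \<or> v \<in> A" "u \<in> D \<or> v \<in> D" for A D
    using that assms refl[of u] refl[of v] sym[of u v] by blast
  then show ?thesis using assms(1) unfolding clans_def by auto
qed

lemma clan_set_subset_iff:
  assumes "A \<subseteq> S" "D \<subseteq> S"
  shows "clan_set S R A \<subseteq> clan_set S R D \<longleftrightarrow> A \<subseteq> D"
proof
  assume sub: "clan_set S R A \<subseteq> clan_set S R D"
  show "A \<subseteq> D"
  proof
    fix u assume "u \<in> A"
    \<comment> \<open>The pair clan with both points equal to \<open>u\<close>, that is, the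
      principal ultrafilter at \<open>u\<close>.\<close>
    then have "{E. E \<subseteq> S \<and> (u \<in> E \<or> u \<in> E)} \<in> clan_set S R A"
      using pair_clan[of u u] refl assms unfolding clan_set_def by blast
    then show "u \<in> D" using sub by (auto simp: clan_set_def)
  qed
next
  assume "A \<subseteq> D"
  then show "clan_set S R A \<subseteq> clan_set S R D"
    using clan_set_Un[OF assms, of R] by (auto simp: Un_absorb1)
qed

lemma clan_set_Int_nonempty_iff:
  assumes "A \<subseteq> S" "D \<subseteq> S"
  shows "clan_set S R A \<inter> clan_set S R D \<noteq> {} \<longleftrightarrow> (\<exists>u\<in>A. \<exists>v\<in>D. R u v)"
proof
  assume "clan_set S R A \<inter> clan_set S R D \<noteq> {}"
  then show "\<exists>u\<in>A. \<exists>v\<in>D. R u v" unfolding clan_set_def clans_def by blast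
next
  assume "\<exists>u\<in>A. \<exists>v\<in>D. R u v"
  then obtain u v where "u \<in> A" "v \<in> D" "R u v" by blast
  then have "{E. E \<subseteq> S \<and> (u \<in> E \<or> v \<in> E)} \<in> clan_set S R A \<inter> clan_set S R D"
    using pair_clan[of u v] assms unfolding clan_set_def by blast
  then show "clan_set S R A \<inter> clan_set S R D \<noteq> {}" by blast
qed

text \<open>The complement of \<open>clan_set S R (S - A)\<close> is an open subset of
  \<open>clan_set S R A\<close>. It is dense there, because every basic closed set that includes it
  includes all of \<open>clan_set S R A\<close>.\<close>

lemma regular_closed_clan_set:
  assumes A: "A \<subseteq> S"
  shows "clan_set S R A \<in> regular_closed_sets (clan_space S R)"
proof -
  let ?T = "clan_space S R" and ?h = "clan_set S R"
  have cover: "?h A \<union> ?h (S - A) = clans S R"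
    using clan_set_Un[of A S "S - A" R] A by (simp add: Un_absorb1 clan_set_full)
  have "?T closure_of (?T interior_of ?h A) \<subseteq> ?h A"
    by (meson A closedin_clan_set closure_of_minimal interior_of_subset)
  moreover have "?h A \<subseteq> ?T closure_of (?T interior_of ?h A)"
  proof -
    let ?F = "?T closure_of (?T interior_of ?h A)"
    have "clans S R - ?h (S - A) \<subseteq> ?T interior_of ?h A"
      using cover by (intro interior_of_maximal openin_compl_clan_set) auto
    also have "\<dots> \<subseteq> ?F"
      by (intro closure_of_subset interior_of_subset_topspace)
    finally have F: "clans S R - ?h (S - A) \<subseteq> ?F" .
    have "?h A \<subseteq> ?h D" if D: "D \<subseteq> S" "?F \<subseteq> ?h D" for D
    proof -
      \<comment> \<open>A clan lies either in \<open>?h (S - A)\<close> or in its complement, and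
        the latter is inside \<open>?h D\<close>. Hence \<open>D\<close> and \<open>S - A\<close>
        cover \<open>S\<close>, which forces \<open>A \<subseteq> D\<close>.\<close>
      have "?h S \<subseteq> ?h (D \<union> (S - A))"
        using F D clan_set_Un[of D S "S - A" R] clan_set_full[of S R] by auto
      then have "S \<subseteq> D \<union> (S - A)" using clan_set_subset_iff[of S "D \<union> (S - A)"] D by auto
      then show ?thesis using clan_set_subset_iff A D by blast
    qed
    moreover have "?F = clans S R \<inter> \<Inter>(?h ` {D. D \<subseteq> S \<and> ?F \<subseteq> ?h D})"
      by (intro closedin_clan_space_Inter closedin_closure_of)
    ultimately show ?thesis using clan_set_subset[of S R A]
      by (metis (no_types, lifting) INT_greatest Int_greatest mem_Collect_eq)
  qed
  ultimately show ?thesis using clan_set_subset[of S R A] by (simp add: regular_closed_sets_def)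
qed

lemma semiregular_clan_space: "semiregular_space (clan_space S R)"
  unfolding semiregular_space_def
proof (intro allI impI)
  fix F assume "closedin (clan_space S R) F"
  from closedin_clan_space_Inter[OF this]
  show "\<exists>\<A>\<subseteq>regular_closed_sets (clan_space S R). F = topspace (clan_space S R) \<inter> \<Inter>\<A>"
    using regular_closed_clan_set
    by (intro exI[of _ "clan_set S R ` {A. A \<subseteq> S \<and> F \<subseteq> clan_set S R A}"]) auto
qed

end

section \<open>Prime filters\<close>

context dcjs
begin

definition ideal :: "'a set \<Rightarrow> bool" where
  "ideal I \<longleftrightarrow> I \<subseteq> univ B \<and> \<zero> \<in> I \<and> (\<forall>x\<in>I. \<forall>y\<in>I. x \<oplus> y \<in> I) \<and>
     (\<forall>x\<in>I. \<forall>y\<in>univ B. y \<preceq> x \<longrightarrow> y \<in> I)"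

text \<open>In the absence of meets, filters are required to be down-directed. That the complement
  is an ideal says at once that \<open>U\<close> is upward closed, omits \<open>\<zero>\<close> and
  is prime.\<close>

definition prime_filters :: "'a set set" where
  "prime_filters = {U. U \<subseteq> univ B \<and> ideal (univ B - U) \<and> U \<noteq> {} \<and>
     (\<forall>x\<in>U. \<forall>y\<in>U. \<exists>z\<in>U. z \<preceq> x \<and> z \<preceq> y)}"

lemma le_plus2: "x \<in> univ B \<Longrightarrow> y \<in> univ B \<Longrightarrow> y \<preceq> x \<oplus> y"
  using le_plus[of y x] plus_commute[of x y] by simp

lemma le_plus_trans:
  "x \<in> univ B \<Longrightarrow> y \<in> univ B \<Longrightarrow> z \<in> univ B \<Longrightarrow> z \<preceq> x \<Longrightarrow> z \<preceq> x \<oplus> y"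
  by (rule le_trans[OF _ _ plus_closed _ le_plus])

lemma le_plus_trans2:
  "x \<in> univ B \<Longrightarrow> y \<in> univ B \<Longrightarrow> z \<in> univ B \<Longrightarrow> z \<preceq> y \<Longrightarrow> z \<preceq> x \<oplus> y"
  by (rule le_trans[OF _ _ plus_closed _ le_plus2])

lemma plus_mono:
  "\<lbrakk>x \<in> univ B; y \<in> univ B; x' \<in> univ B; y' \<in> univ B; x \<preceq> x'; y \<preceq> y'\<rbrakk> \<Longrightarrow> x \<oplus> y \<preceq> x' \<oplus> y'"
  by (simp add: plus_least le_plus_trans le_plus_trans2 plus_closed)

lemma ideal_mono: "ideal I \<Longrightarrow> x \<in> I \<Longrightarrow> y \<in> univ B \<Longrightarrow> y \<preceq> x \<Longrightarrow> y \<in> I"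
  by (auto simp: ideal_def)

lemma ideal_plus: "ideal I \<Longrightarrow> x \<in> I \<Longrightarrow> y \<in> I \<Longrightarrow> x \<oplus> y \<in> I"
  by (auto simp: ideal_def)

lemma ideal_univ: "ideal I \<Longrightarrow> x \<in> I \<Longrightarrow> x \<in> univ B"
  by (auto simp: ideal_def)

section \<open>Maximal ideals and separation by prime filters\<close>

text \<open>The ideal obtained by adjoining \<open>x\<close> to \<open>P\<close>, to be played
  against the maximality of \<open>P\<close>.\<close>

lemma ideal_generated:
  assumes P: "ideal P" and x: "x \<in> univ B"
  shows "ideal {z \<in> univ B. \<exists>p\<in>P. z \<preceq> p \<oplus> x}" (is "ideal ?Q")
  unfolding ideal_def
proof (intro conjI ballI impI)
  have "\<zero> \<in> P" using P by (simp add: ideal_def)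
  moreover have "\<zero> \<preceq> \<zero> \<oplus> x" using x zero_closed le_plus by blast
  ultimately show "\<zero> \<in> ?Q" using zero_closed by blast
  fix z assume "z \<in> ?Q"
  then obtain p where p: "z \<in> univ B" "p \<in> P" "z \<preceq> p \<oplus> x" by blast
  note pu = ideal_univ[OF P p(2)]
  show "z' \<in> ?Q" if "z' \<in> univ B" "z' \<preceq> z" for z'
  proof -
    have "z' \<preceq> p \<oplus> x" using that p pu x by (meson le_trans plus_closed)
    then show ?thesis using that p by blast
  qed
  show "z \<oplus> w \<in> ?Q" if "w \<in> ?Q" for w
  proof -
    obtain q where q: "w \<in> univ B" "q \<in> P" "w \<preceq> q \<oplus> x"
      using \<open>w \<in> ?Q\<close> by blast
    note qu = ideal_univ[OF P q(2)]
    have "p \<oplus> x \<preceq> (p \<oplus> q) \<oplus> x" "q \<oplus> x \<preceq> (p \<oplus> q) \<oplus> x"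
      using pu qu x by (simp_all add: plus_mono le_refl le_plus le_plus2 plus_closed)
    then have "z \<preceq> (p \<oplus> q) \<oplus> x" "w \<preceq> (p \<oplus> q) \<oplus> x"
      using p q pu qu x by (meson le_trans plus_closed)+
    then have "z \<oplus> w \<preceq> (p \<oplus> q) \<oplus> x" using p q pu qu x by (simp add: plus_least plus_closed)
    then show ?thesis using ideal_plus[OF P p(2) q(2)] p(1) q(1) by (auto simp: plus_closed)
  qed
qed auto

text \<open>Zorn's lemma: the union of a chain of ideals is an ideal, since any two of its elements
  lie in a common member of the chain.\<close>

lemma maximal_ideal_exists:
  assumes I: "ideal I" "a \<notin> I"
  obtains P where "ideal P" "a \<notin> P" "I \<subseteq> P"
    "\<And>Q. ideal Q \<Longrightarrow> a \<notin> Q \<Longrightarrow> P \<subseteq> Q \<Longrightarrow> Q = P"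
proof -
  let ?\<A> = "{P. ideal P \<and> a \<notin> P \<and> I \<subseteq> P}"
  have "\<exists>M\<in>?\<A>. \<forall>Q\<in>?\<A>. M \<subseteq> Q \<longrightarrow> Q = M"
  proof (rule subset_Zorn_nonempty)
    show "?\<A> \<noteq> {}" using I by blast
    fix \<C> assume C: "\<C> \<noteq> {}" "subset.chain ?\<A> \<C>"
    then have id: "ideal P" and aI: "a \<notin> P" "I \<subseteq> P" if "P \<in> \<C>" for P
      using that by (auto simp: subset_chain_def)
    have "ideal (\<Union>\<C>)"
      unfolding ideal_def
    proof (intro conjI ballI impI)
      show "\<Union>\<C> \<subseteq> univ B" using id ideal_univ by blast
      have "\<zero> \<in> P" if "P \<in> \<C>" for P using id[OF that] by (simp add: ideal_def)
      then show "\<zero> \<in> \<Union>\<C>" using C(1) by blast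
      fix x assume "x \<in> \<Union>\<C>"
      then obtain P where P: "P \<in> \<C>" "x \<in> P" by blast
      show "y \<in> \<Union>\<C>" if "y \<in> univ B" "y \<preceq> x" for y
        using that P id ideal_mono by blast
      show "x \<oplus> y \<in> \<Union>\<C>" if "y \<in> \<Union>\<C>" for y
      proof -
        obtain Q where Q: "Q \<in> \<C>" "y \<in> Q" using \<open>y \<in> \<Union>\<C>\<close> by blast
        then have "P \<subseteq> Q \<or> Q \<subseteq> P" using C(2) P by (auto simp: subset_chain_def)
        then show ?thesis using P Q id ideal_plus by blast
      qed
    qed
    then show "\<Union>\<C> \<in> ?\<A>" using C(1) aI by blast
  qed
  then obtain P where "ideal P" "a \<notin> P" "I \<subseteq> P"
    "\<forall>Q\<in>?\<A>. P \<subseteq> Q \<longrightarrow> Q = P" by blast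
  then show ?thesis by (intro that[of P]) auto
qed

text \<open>Distributivity stands in for meets: splitting \<open>a\<close> along \<open>x\<close>,
  and the resulting part along \<open>y\<close>, leaves a common lower bound \<open>z\<close>. Were
  \<open>z\<close> in \<open>P\<close>, then \<open>a\<close> would be a join of elements of
  \<open>P\<close>.\<close>

lemma maximal_ideal_compl_directed:
  assumes P: "ideal P" and a: "a \<in> univ B" "a \<notin> P"
    and max: "\<And>Q. ideal Q \<Longrightarrow> a \<notin> Q \<Longrightarrow> P \<subseteq> Q \<Longrightarrow> Q = P"
    and x: "x \<in> univ B" "x \<notin> P" and y: "y \<in> univ B" "y \<notin> P"
  obtains z where "z \<in> univ B" "z \<notin> P" "z \<preceq> x" "z \<preceq> y"
proof -
  \<comment> \<open>The ideal generated by \<open>P\<close> and \<open>w\<close> properly extends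
    \<open>P\<close>, so by maximality it contains \<open>a\<close>.\<close>
  have split: "\<exists>p\<in>P. a \<preceq> p \<oplus> w" if w: "w \<in> univ B" "w \<notin> P" for w
  proof (rule ccontr)
    let ?Q = "{z \<in> univ B. \<exists>p\<in>P. z \<preceq> p \<oplus> w}"
    assume "\<not> ?thesis"
    then have "a \<notin> ?Q" by blast
    moreover have "P \<subseteq> ?Q" using ideal_univ[OF P] w le_plus by blast
    ultimately have "?Q = P" using max ideal_generated[OF P w(1)] by blast
    moreover have "\<zero> \<in> P" using P by (simp add: ideal_def)
    then have "w \<in> ?Q" using w(1) le_plus2[of "\<zero>" w] zero_closed by blast
    ultimately show False using w(2) by simp
  qed
  obtain p q where p: "p \<in> P" "a \<preceq> p \<oplus> x" and q: "q \<in> P" "a \<preceq> q \<oplus> y"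
    using split x y by blast
  note pu = ideal_univ[OF P p(1)] and qu = ideal_univ[OF P q(1)]
  obtain p' x' where px: "p' \<in> univ B" "x' \<in> univ B" "p' \<preceq> p" "x' \<preceq> x" "a = p' \<oplus> x'"
    using distrib[OF a(1) pu x(1) p(2)] by blast
  have "x' \<preceq> a" using px le_plus2 by simp
  \<comment> \<open>The second splitting is applied to \<open>x'\<close> rather than to
    \<open>a\<close>, so that the new part \<open>z\<close> is below \<open>x\<close> as well as
    below \<open>y\<close>.\<close>
  then have "x' \<preceq> q \<oplus> y" using q(2) px a(1) qu y(1) by (meson le_trans plus_closed)
  then obtain q' z where qz: "q' \<in> univ B" "z \<in> univ B" "q' \<preceq> q" "z \<preceq> y" "x' = q' \<oplus> z"
    using distrib[OF px(2) qu y(1)] by blast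
  have "z \<preceq> x'" using qz le_plus2 by simp
  then have "z \<preceq> x" using px qz x by (meson le_trans)
  moreover have "z \<notin> P"
  proof
    assume "z \<in> P"
    then have "x' \<in> P" using qz q P ideal_mono ideal_plus by blast
    then have "a \<in> P" using px p P ideal_mono ideal_plus by blast
    with a(2) show False by contradiction
  qed
  ultimately show thesis using that qz by blast
qed

text \<open>\<open>U\<close> is the complement of an ideal that includes \<open>I\<close> and is
  maximal among the ideals avoiding \<open>a\<close>.\<close>

lemma prime_filter_exists:
  assumes "ideal I" "a \<in> univ B" "a \<notin> I"
  obtains U where "U \<in> prime_filters" "a \<in> U" "U \<inter> I = {}"
proof -
  obtain P where P: "ideal P" "a \<notin> P" "I \<subseteq> P"
    and max: "\<And>Q. ideal Q \<Longrightarrow> a \<notin> Q \<Longrightarrow> P \<subseteq> Q \<Longrightarrow> Q = P"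
    using maximal_ideal_exists[OF assms(1,3)] by blast
  have "univ B - (univ B - P) = P" using P(1) by (auto simp: ideal_def)
  moreover have "\<exists>z\<in>univ B - P. z \<preceq> x \<and> z \<preceq> y" if "x \<in> univ B - P" "y \<in> univ B - P" for x y
    using maximal_ideal_compl_directed[OF P(1) assms(2) P(2) max, of x y] that by blast
  ultimately have "univ B - P \<in> prime_filters"
    using P assms(2) unfolding prime_filters_def by auto
  then show thesis using that P assms(2) by blast
qed

lemma prime_filter_univ: "U \<in> prime_filters \<Longrightarrow> x \<in> U \<Longrightarrow> x \<in> univ B"
  by (auto simp: prime_filters_def)

lemma prime_filter_directed:
  "U \<in> prime_filters \<Longrightarrow> x \<in> U \<Longrightarrow> y \<in> U \<Longrightarrow> \<exists>z\<in>U. z \<preceq> x \<and> z \<preceq> y"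
  by (auto simp: prime_filters_def)

lemma prime_filter_mono:
  "U \<in> prime_filters \<Longrightarrow> x \<in> U \<Longrightarrow> y \<in> univ B \<Longrightarrow> x \<preceq> y \<Longrightarrow> y \<in> U"
  unfolding prime_filters_def ideal_def by blast

lemma prime_filter_zero: "U \<in> prime_filters \<Longrightarrow> \<zero> \<notin> U"
  by (auto simp: prime_filters_def ideal_def)

lemma prime_filter_one:
  assumes U: "U \<in> prime_filters"
  shows "\<one> \<in> U"
proof -
  obtain x where "x \<in> U" using U by (auto simp: prime_filters_def)
  then show ?thesis using prime_filter_mono[OF U _ one_closed le_one] prime_filter_univ[OF U] by blast
qed

lemma prime_filter_plus_iff:
  assumes U: "U \<in> prime_filters" and "x \<in> univ B" "y \<in> univ B"
  shows "x \<oplus> y \<in> U \<longleftrightarrow> x \<in> U \<or> y \<in> U"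
proof
  show "x \<oplus> y \<in> U \<Longrightarrow> x \<in> U \<or> y \<in> U"
    using assms unfolding prime_filters_def ideal_def by blast
  show "x \<in> U \<or> y \<in> U \<Longrightarrow> x \<oplus> y \<in> U"
    using prime_filter_mono[OF U _ plus_closed[OF assms(2,3)]] le_plus[OF assms(2,3)]
      le_plus2[OF assms(2,3)] by blast
qed

section \<open>Contact between prime filters\<close>

definition linked :: "'a set \<Rightarrow> 'a set \<Rightarrow> bool" where
  "linked U V \<longleftrightarrow> (\<forall>x\<in>U. \<forall>y\<in>V. x \<bowtie> y)"

lemma contact_mono2:
  "\<lbrakk>x \<in> univ B; y \<in> univ B; x' \<in> univ B; y' \<in> univ B; x \<bowtie> y; x \<preceq> x'; y \<preceq> y'\<rbrakk> \<Longrightarrow> x' \<bowtie> y'"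
  using contact_mono[of x y y'] contact_sym[of x y'] contact_mono[of y' x x'] contact_sym[of y' x']
  by blast

text \<open>Two members of \<open>U\<close> have a common lower bound in \<open>U\<close>. It is
  nonzero, hence in contact with itself, and this contact passes upward.\<close>

lemma linked_refl:
  assumes U: "U \<in> prime_filters"
  shows "linked U U"
  unfolding linked_def
proof (intro ballI)
  fix x y assume xy: "x \<in> U" "y \<in> U"
  then obtain z where z: "z \<in> U" "z \<preceq> x" "z \<preceq> y" using prime_filter_directed[OF U] by blast
  then have "z \<bowtie> z" using prime_filter_zero[OF U] prime_filter_univ[OF U] contact_refl by blast
  then show "x \<bowtie> y" using z xy prime_filter_univ[OF U] contact_mono2 by blast
qed

lemma linked_sym:
  "U \<in> prime_filters \<Longrightarrow> V \<in> prime_filters \<Longrightarrow> linked U V \<Longrightarrow> linked V U"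
  unfolding linked_def using contact_sym prime_filter_univ by blast

text \<open>Since \<open>V\<close> is down-directed, the elements out of contact with some element of \<open>V\<close>
  are closed under joins.\<close>

lemma ideal_not_contact:
  assumes V: "V \<subseteq> univ B" "V \<noteq> {}"
    and dir: "\<And>x y. x \<in> V \<Longrightarrow> y \<in> V \<Longrightarrow> \<exists>z\<in>V. z \<preceq> x \<and> z \<preceq> y"
  shows "ideal {x \<in> univ B. \<exists>y\<in>V. \<not> x \<bowtie> y}" (is "ideal ?J")
  unfolding ideal_def
proof (intro conjI ballI impI)
  obtain v where "v \<in> V" using V(2) by blast
  then have "\<not> \<zero> \<bowtie> v" using V(1) contact_nonzero[OF zero_closed] by blast
  then show "\<zero> \<in> ?J" using \<open>v \<in> V\<close> zero_closed by blast
  fix x assume "x \<in> ?J"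
  then obtain u where x: "x \<in> univ B" "u \<in> V" "\<not> x \<bowtie> u" by blast
  show "y \<in> ?J" if "y \<in> univ B" "y \<preceq> x" for y
    using that x V(1) contact_mono2 le_refl by blast
  show "x \<oplus> y \<in> ?J" if "y \<in> ?J" for y
  proof -
    obtain v where y: "y \<in> univ B" "v \<in> V" "\<not> y \<bowtie> v" using \<open>y \<in> ?J\<close> by blast
    obtain w where w: "w \<in> V" "w \<preceq> u" "w \<preceq> v" using dir x y by blast
    have wu: "u \<in> univ B" "v \<in> univ B" "w \<in> univ B" using x y w V(1) by auto
    have "\<not> w \<bowtie> x" "\<not> w \<bowtie> y"
      using x y w wu contact_mono contact_sym by blast+
    then have "\<not> w \<bowtie> x \<oplus> y" using contact_plus wu x y by blast
    then have "\<not> x \<oplus> y \<bowtie> w" using contact_sym wu x y plus_closed by blast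
    then show ?thesis using w x y plus_closed by blast
  qed
qed auto

text \<open>The filters are built one after the other: first \<open>V\<close> around
  \<open>b\<close> with all members in contact with \<open>a\<close>, then \<open>U\<close> around
  \<open>a\<close> with all members in contact with all of \<open>V\<close>.\<close>

lemma contact_iff_linked:
  assumes a: "a \<in> univ B" and b: "b \<in> univ B"
  shows "a \<bowtie> b \<longleftrightarrow> (\<exists>U\<in>prime_filters. \<exists>V\<in>prime_filters. a \<in> U \<and> b \<in> V \<and> linked U V)"
proof
  assume ab: "a \<bowtie> b"
  \<comment> \<open>The singleton \<open>{a}\<close> is trivially directed, so the elements not in
    contact with \<open>a\<close> form an ideal.\<close>
  have I: "ideal {x \<in> univ B. \<exists>y\<in>{a}. \<not> x \<bowtie> y}"
    using a le_refl by (intro ideal_not_contact) auto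
  have bI: "b \<notin> {x \<in> univ B. \<exists>y\<in>{a}. \<not> x \<bowtie> y}" using ab a b contact_sym by blast
  obtain V where V: "V \<in> prime_filters" "b \<in> V"
      and V': "V \<inter> {x \<in> univ B. \<exists>y\<in>{a}. \<not> x \<bowtie> y} = {}"
    by (rule prime_filter_exists[OF I b bI])
  have aV: "a \<bowtie> y" if "y \<in> V" for y
    using that V' prime_filter_univ[OF V(1)] contact_sym a by blast
  have J: "ideal {x \<in> univ B. \<exists>y\<in>V. \<not> x \<bowtie> y}"
    using V prime_filter_univ[OF V(1)] prime_filter_directed[OF V(1)]
    by (intro ideal_not_contact) auto
  \<comment> \<open>The choice of \<open>V\<close> keeps \<open>a\<close> out of the second ideal,
    so a prime filter can be separated from it.\<close>
  have aJ: "a \<notin> {x \<in> univ B. \<exists>y\<in>V. \<not> x \<bowtie> y}" using aV by blast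
  obtain U where U: "U \<in> prime_filters" "a \<in> U"
      and U': "U \<inter> {x \<in> univ B. \<exists>y\<in>V. \<not> x \<bowtie> y} = {}"
    by (rule prime_filter_exists[OF J a aJ])
  have "linked U V" using U' prime_filter_univ[OF U(1)] unfolding linked_def by blast
  then show "\<exists>U\<in>prime_filters. \<exists>V\<in>prime_filters. a \<in> U \<and> b \<in> V \<and> linked U V"
    using U V by blast
qed (auto simp: linked_def)

section \<open>Representation by sets of prime filters\<close>

definition prime_filters_of :: "'a \<Rightarrow> 'a set set" where
  "prime_filters_of a = {U \<in> prime_filters. a \<in> U}"

lemma prime_filters_of_subset: "prime_filters_of a \<subseteq> prime_filters"
  by (auto simp: prime_filters_of_def)

lemma prime_filters_of_zero: "prime_filters_of \<zero> = {}"
  by (auto simp: prime_filters_of_def prime_filter_zero)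

lemma prime_filters_of_one: "prime_filters_of \<one> = prime_filters"
  by (auto simp: prime_filters_of_def prime_filter_one)

lemma prime_filters_of_plus:
  "a \<in> univ B \<Longrightarrow> b \<in> univ B \<Longrightarrow>
    prime_filters_of (a \<oplus> b) = prime_filters_of a \<union> prime_filters_of b"
  by (auto simp: prime_filters_of_def prime_filter_plus_iff)

text \<open>If \<open>a \<preceq> b\<close> fails, then \<open>a\<close> is outside the principal
  ideal of \<open>b\<close>, and a prime filter around \<open>a\<close> avoiding that ideal omits
  \<open>b\<close>.\<close>

lemma prime_filters_of_subset_iff:
  assumes a: "a \<in> univ B" and b: "b \<in> univ B"
  shows "prime_filters_of a \<subseteq> prime_filters_of b \<longleftrightarrow> a \<preceq> b"
proof
  assume sub: "prime_filters_of a \<subseteq> prime_filters_of b"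
  show "a \<preceq> b"
  proof (rule ccontr)
    assume "\<not> a \<preceq> b"
    then have ab: "a \<notin> {x \<in> univ B. x \<preceq> b}" by simp
    have I: "ideal {x \<in> univ B. x \<preceq> b}"
      unfolding ideal_def
    proof (intro conjI ballI impI)
      show "\<zero> \<in> {x \<in> univ B. x \<preceq> b}" using b zero_closed zero_le by blast
      show "x \<oplus> y \<in> {x \<in> univ B. x \<preceq> b}"
        if "x \<in> {x \<in> univ B. x \<preceq> b}" "y \<in> {x \<in> univ B. x \<preceq> b}" for x y
        using that b plus_closed plus_least by blast
      show "y \<in> {x \<in> univ B. x \<preceq> b}"
        if "x \<in> {x \<in> univ B. x \<preceq> b}" "y \<in> univ B" "y \<preceq> x" for x y
        using that b le_trans[of y x b] by blast
    qed blast
    obtain U where U: "U \<in> prime_filters" "a \<in> U" "U \<inter> {x \<in> univ B. x \<preceq> b} = {}"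
      by (rule prime_filter_exists[OF I a ab])
    then have "b \<in> U" using sub unfolding prime_filters_of_def by blast
    then show False using U(3) b le_refl by blast
  qed
next
  assume "a \<preceq> b"
  then show "prime_filters_of a \<subseteq> prime_filters_of b"
    using b prime_filter_mono by (auto simp: prime_filters_of_def)
qed

end

section \<open>The embedding into the regular closed sets of the clan space\<close>

theorem mainTheorem4:
  fixes B :: "'a contact_structure"
  assumes "dcjs B"
  shows "\<exists>(X :: 'a set set set topology) h.
           compact_space X \<and> semiregular_space X \<and> t0_space X \<and>
           isomorphic_embedding h B (RC_structure X)"
proof -
  interpret dcjs B by fact
  let ?S = prime_filters and ?g = prime_filters_of
  let ?X = "clan_space ?S linked"
  \<comment> \<open>The composite of the representation by prime filters and the clan representation
    of their power set. If \<open>B\<close> has one element, there are no prime filters, hence no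
    clans, and \<open>?X\<close> is empty.\<close>
  let ?h = "\<lambda>a. clan_set ?S linked (?g a)"
  note gS = prime_filters_of_subset
  have le: "?h a \<subseteq> ?h b \<longleftrightarrow> a \<preceq>\<^bsub>B\<^esub> b" if "a \<in> univ B" "b \<in> univ B" for a b
  proof -
    have "?h a \<subseteq> ?h b \<longleftrightarrow> ?g a \<subseteq> ?g b"
      by (rule clan_set_subset_iff) (auto simp: linked_refl linked_sym gS)
    then show ?thesis using prime_filters_of_subset_iff[OF that] by simp
  qed
  have contact: "?h a \<inter> ?h b \<noteq> {} \<longleftrightarrow> a \<bowtie>\<^bsub>B\<^esub> b" if "a \<in> univ B" "b \<in> univ B" for a b
  proof -
    have "?h a \<inter> ?h b \<noteq> {} \<longleftrightarrow> (\<exists>U\<in>?g a. \<exists>V\<in>?g b. linked U V)"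
      by (rule clan_set_Int_nonempty_iff) (auto simp: linked_refl linked_sym prime_filters_of_def)
    then show ?thesis
      using contact_iff_linked[OF that] by (auto simp: prime_filters_of_def)
  qed
  have "inj_on ?h (univ B)"
    by (rule inj_onI) (metis le le_antisym order_refl)
  moreover have "?h ` univ B \<subseteq> regular_closed_sets ?X"
    by (intro image_subsetI regular_closed_clan_set gS) (auto simp: linked_refl linked_sym)
  moreover have "?h (a \<oplus>\<^bsub>B\<^esub> b) = ?h a \<union> ?h b" if "a \<in> univ B" "b \<in> univ B" for a b
    using that by (simp add: prime_filters_of_plus clan_set_Un gS)
  ultimately have "isomorphic_embedding ?h B (RC_structure ?X)"
    unfolding isomorphic_embedding_def RC_structure_def
    by (simp add: le contact prime_filters_of_zero prime_filters_of_one clan_set_empty clan_set_full)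
  moreover have "semiregular_space ?X"
    by (rule semiregular_clan_space) (auto simp: linked_refl linked_sym)
  ultimately show ?thesis
    using compact_clan_space t0_clan_space by blast
qed

end
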